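(* Let $\chi$ be a Dirichlet character with odd conductor $d\in\mathbb{N}$, and let $w_1,w_2\in\mathbb{N}$ be odd positive integers. Then for every integer $l\ge 0$, as an identity of polynomials in $x$, $$\sum_{i=0}^{l}\binom{l}{i}E_{i,\chi}(w_2x)\,T_{l-i,\chi}(dw_1-1)\,w_1^{i}w_2^{l-i}=\sum_{i=0}^{l}\binom{l}{i}E_{i,\chi}(w_1x)\,T_{l-i,\chi}(dw_2-1)\,w_2^{i}w_1^{l-i}.$$
   Context: $\mathbb{N}$ denotes the positive integers. A Dirichlet character $\chi$ of conductor $d$ is regarded as a $d$-periodic function on $\mathbb{Z}$, with $\chi(l)=0$ when $\gcd(l,d)>1$ (for $d=1$, $\chi$ is identically $1$). Its values may be taken in $\mathbb{C}$, or in $\mathbb{C}_p$ for an odd prime $p$ with $\gcd(p,d)=1$. The generalized Euler polynomials $E_{n,\chi}(x)$ ($n\ge 0$) attached to $\chi$ are defined by the formal power series identity in $t$ $$\frac{2\sum_{l=0}^{d-1}(-1)^l\chi(l)e^{lt}}{e^{dt}+1}\,e^{xt}=\sum_{n=0}^{\infty}E_{n,\chi}(x)\frac{t^n}{n!}.$$ For integers $k,n\ge 0$, set $$T_{k,\chi}(n)=2\sum_{l=0}^{n}(-1)^l\chi(l)\,l^k,$$ with the convention $0^0=1$. *)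

theory Defs
  imports "HOL-Computational_Algebra.Computational_Algebra"
begin

(* Values lie in an arbitrary field of characteristic 0; the complex numbers and the
   field C_p are both of this kind. *)
definition dirichlet_character :: "nat \<Rightarrow> (int \<Rightarrow> 'a::field_char_0) \<Rightarrow> bool" where
  "dirichlet_character m \<chi> \<longleftrightarrow>
     m > 0 \<and>
     (\<forall>a. \<chi> (a + int m) = \<chi> a) \<and>
     (\<forall>a b. \<chi> (a * b) = \<chi> a * \<chi> b) \<and>
     (\<forall>a. \<chi> a = 0 \<longleftrightarrow> \<not> coprime a (int m))"

(* The conductor of a character modulo m is the least divisor f of m such that the character
   comes from one modulo f. *)
definition conductor :: "nat \<Rightarrow> (int \<Rightarrow> 'a::field_char_0) \<Rightarrow> nat" where
  "conductor m \<chi> =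
     (LEAST f. f dvd m \<and>
       (\<exists>\<psi> :: int \<Rightarrow> 'a. dirichlet_character f \<psi> \<and> (\<forall>a. coprime a (int m) \<longrightarrow> \<chi> a = \<psi> a)))"

(* A character of conductor d is viewed as a function of period d, so its modulus is d too. *)
definition dirichlet_character_of_conductor :: "nat \<Rightarrow> (int \<Rightarrow> 'a::field_char_0) \<Rightarrow> bool" where
  "dirichlet_character_of_conductor d \<chi> \<longleftrightarrow> dirichlet_character d \<chi> \<and> conductor d \<chi> = d"

(* The factor of the generating function that does not involve x. The denominator has
   constant term 2, so this is an exact quotient (gen_euler_kernel_mult). *)
definition gen_euler_kernel :: "nat \<Rightarrow> (int \<Rightarrow> 'a::field_char_0) \<Rightarrow> 'a fps" where
  "gen_euler_kernel d \<chi> =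
     2 * (\<Sum>l<d. fps_const ((-1) ^ l * \<chi> (int l)) * fps_exp (of_nat l))
       / (fps_exp (of_nat d) + 1)"

(* The generating function is a power series in t over the polynomials in x. *)
definition gen_euler_gf :: "nat \<Rightarrow> (int \<Rightarrow> 'a::field_char_0) \<Rightarrow> 'a poly fps" where
  "gen_euler_gf d \<chi> =
     Abs_fps (\<lambda>n. [:gen_euler_kernel d \<chi> $ n:]) * Abs_fps (\<lambda>n. monom (1 / fact n) n)"

definition gen_euler_poly :: "nat \<Rightarrow> (int \<Rightarrow> 'a::field_char_0) \<Rightarrow> nat \<Rightarrow> 'a poly" where
  "gen_euler_poly d \<chi> n = smult (fact n) (gen_euler_gf d \<chi> $ n)"

definition alt_power_sum :: "(int \<Rightarrow> 'a::field_char_0) \<Rightarrow> nat \<Rightarrow> nat \<Rightarrow> 'a" where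
  "alt_power_sum \<chi> k n = 2 * (\<Sum>l\<le>n. (-1) ^ l * \<chi> (int l) * of_nat l ^ k)"

lemma gen_euler_kernel_mult:
  fixes \<chi> :: "int \<Rightarrow> 'a::field_char_0"
  shows "gen_euler_kernel d \<chi> * (fps_exp (of_nat d) + 1) =
     2 * (\<Sum>l<d. fps_const ((-1) ^ l * \<chi> (int l)) * fps_exp (of_nat l))"
proof -
  have "(fps_exp (of_nat d) + 1 :: 'a fps) $ 0 \<noteq> 0"
    by simp
  then show ?thesis
    unfolding gen_euler_kernel_def
    by (simp add: fps_divide_unit mult.assoc inverse_mult_eq_1)
qed

lemma gen_euler_poly_gf:
  "Abs_fps (\<lambda>n. poly (gen_euler_poly d \<chi> n) x / fact n) = gen_euler_kernel d \<chi> * fps_exp x"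
proof (rule fps_ext)
  fix n
  show "Abs_fps (\<lambda>n. poly (gen_euler_poly d \<chi> n) x / fact n) $ n =
      (gen_euler_kernel d \<chi> * fps_exp x) $ n"
    by (simp add: gen_euler_poly_def gen_euler_gf_def fps_mult_nth poly_sum poly_monom)
qed

lemma dirichlet_character_one:
  "dirichlet_character 1 \<chi> \<longleftrightarrow> \<chi> = (\<lambda>_. 1)"
proof
  assume *: "dirichlet_character 1 \<chi>"
  have "\<chi> 1 * \<chi> 1 = \<chi> 1"
    using * unfolding dirichlet_character_def by (metis mult_1)
  moreover have nz: "\<chi> a \<noteq> 0" for a
    using * by (simp add: dirichlet_character_def)
  moreover have "\<chi> a * \<chi> 0 = \<chi> 0" for a
    using * unfolding dirichlet_character_def by (metis mult_zero_right)
  ultimately show "\<chi> = (\<lambda>_. 1)"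
    by (intro ext) (metis mult_cancel_right1)
qed (simp add: dirichlet_character_def)

end

theory Submission
  imports Defs
begin

text \<open>Write \<open>K(t)\<close> for the kernel, so that \<open>K(t) e^{xt}\<close> generates the polynomials. Grouping the
  alternating character sum of length \<open>dw\<close> into blocks of length \<open>d\<close> (\<open>d\<close>, \<open>w\<close> odd) shows that the
  exponential generating function of the alternating power sums is \<open>K(t) (e^{dwt} + 1)\<close>. Hence,
  up to \<open>l!\<close>, the left-hand side is the coefficient of \<open>t^l\<close> in
  \<open>K(w1 t) K(w2 t) (e^{d w1 w2 t} + 1) e^{w1 w2 x t}\<close>, which is symmetric in \<open>w1\<close> and \<open>w2\<close>.\<close>

lemma dirichlet_character_add_mult:
  assumes "dirichlet_character m \<chi>"
  shows "\<chi> (int (m * k + r)) = \<chi> (int r)"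
proof (induction k)
  case (Suc k)
  have "int (m * Suc k + r) = int (m * k + r) + int m"
    by simp
  then show ?case
    using assms Suc unfolding dirichlet_character_def by metis
qed simp

text \<open>By periodicity and odd \<open>d\<close>, moving \<open>l\<close> by \<open>d\<close>
  multiplies \<open>g l\<close> by \<open>- fps_exp (of_nat d)\<close>. The blocks thus form a
  geometric series, which the factor \<open>fps_exp (of_nat d) + 1\<close> telescopes.\<close>

lemma alternating_character_exp_sum:
  fixes \<chi> :: "int \<Rightarrow> 'a::field_char_0"
  assumes \<chi>: "dirichlet_character d \<chi>" and "odd d"
  defines "g \<equiv> \<lambda>l. fps_const ((-1) ^ l * \<chi> (int l)) * fps_exp (of_nat l)"
  shows "(fps_exp (of_nat d) + 1) * (\<Sum>l<d * w. g l)
           = (\<Sum>l<d. g l) * (1 - (-1) ^ w * fps_exp (of_nat (d * w)))"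
proof (induction w)
  case (Suc w)
  have shift: "g (d * w + r) = (-1) ^ w * fps_exp (of_nat (d * w)) * g r" for r
  proof -
    have "(-1 :: 'a) ^ (d * w + r) = (-1) ^ w * (-1) ^ r"
      using \<open>odd d\<close> by (simp add: power_add power_mult)
    then have "g (d * w + r) = fps_const ((-1) ^ w * ((-1) ^ r * \<chi> (int r)))
        * (fps_exp (of_nat (d * w)) * fps_exp (of_nat r))"
      unfolding g_def dirichlet_character_add_mult[OF \<chi>]
      by (simp add: mult_ac flip: fps_exp_add_mult)
    moreover have "fps_const ((-1) ^ w) = ((-1) ^ w :: 'a fps)"
      by (cases "even w") (simp_all flip: fps_const_neg)
    ultimately show ?thesis
      unfolding g_def by (simp add: mult_ac flip: fps_const_mult)
  qed
  have "(\<Sum>l<d * w + k. g l) = (\<Sum>l<d * w. g l) + (\<Sum>r<k. g (d * w + r))" for k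
    by (induction k) (simp_all add: add.assoc)
  then have "(\<Sum>l<d * Suc w. g l) = (\<Sum>l<d * w. g l) + (\<Sum>r<d. g (d * w + r))"
    by (metis add.commute mult_Suc_right)
  also have "\<dots> = (\<Sum>l<d * w. g l) + (-1) ^ w * fps_exp (of_nat (d * w)) * (\<Sum>r<d. g r)"
    by (simp add: shift sum_distrib_left)
  finally show ?case
    using Suc by (simp add: algebra_simps fps_exp_add_mult)
qed simp

lemma alt_power_sum_gf:
  fixes \<chi> :: "int \<Rightarrow> 'a::field_char_0"
  assumes \<chi>: "dirichlet_character d \<chi>" and "odd d" and "odd w"
  shows "Abs_fps (\<lambda>n. alt_power_sum \<chi> n (d * w - 1) / fact n)
           = gen_euler_kernel d \<chi> * (fps_exp (of_nat (d * w)) + 1)"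
proof -
  define g :: "nat \<Rightarrow> 'a fps"
    where "g = (\<lambda>l. fps_const ((-1) ^ l * \<chi> (int l)) * fps_exp (of_nat l))"
  let ?D = "fps_exp (of_nat d) + 1 :: 'a fps"
  \<comment> \<open>Positivity makes the truncated difference \<open>d * w - 1\<close> the true last
    index, so the sum has exactly \<open>d * w\<close> terms.\<close>
  have "d * w > 0"
    using \<open>odd d\<close> \<open>odd w\<close> by (simp add: odd_pos)
  then have "{..d * w - 1} = {..<d * w}"
    by (metis Suc_pred' lessThan_Suc_atMost)
  then have T: "Abs_fps (\<lambda>n. alt_power_sum \<chi> n (d * w - 1) / fact n) = 2 * (\<Sum>l<d * w. g l)"
    by (intro fps_ext)
      (simp add: alt_power_sum_def g_def fps_sum_nth sum_divide_distrib sum_distrib_left numeral_fps_const)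
  have "?D * (2 * (\<Sum>l<d * w. g l)) = 2 * (?D * (\<Sum>l<d * w. g l))"
    by (rule mult.left_commute)
  also have "\<dots> = (2 * (\<Sum>l<d. g l)) * (fps_exp (of_nat (d * w)) + 1)"
    using alternating_character_exp_sum[OF \<chi> \<open>odd d\<close>, of w] \<open>odd w\<close>
    by (simp add: g_def algebra_simps)
  also have "\<dots> = ?D * (gen_euler_kernel d \<chi> * (fps_exp (of_nat (d * w)) + 1))"
    using gen_euler_kernel_mult[of d \<chi>] by (simp add: g_def mult_ac)
  finally have "?D * (2 * (\<Sum>l<d * w. g l))
      = ?D * (gen_euler_kernel d \<chi> * (fps_exp (of_nat (d * w)) + 1))" .
  \<comment> \<open>The constant term is 2, so \<open>?D\<close> can be cancelled in the integral
    domain of power series.\<close>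
  moreover have "?D $ 0 \<noteq> 0"
    by simp
  then have "?D \<noteq> 0"
    by force
  ultimately show ?thesis
    using T by simp
qed

text \<open>The weights \<open>of_nat w ^ i\<close> and \<open>of_nat v ^ (l - i)\<close> come from
  substituting wt and vt for t in the two generating functions; the binomial sum is their Cauchy
  product.\<close>

lemma gen_euler_alt_power_sum_gf:
  fixes \<chi> :: "int \<Rightarrow> 'a::field_char_0"
  assumes \<chi>: "dirichlet_character d \<chi>" and "odd d" and "odd w"
  shows "(\<Sum>i\<le>l. of_nat (l choose i) * (alt_power_sum \<chi> (l - i) (d * w - 1) * of_nat w ^ i * of_nat v ^ (l - i)
             * poly (gen_euler_poly d \<chi> i) (of_nat v * x))) / fact l
       = ((gen_euler_kernel d \<chi> oo (fps_const (of_nat w) * fps_X))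
           * (gen_euler_kernel d \<chi> oo (fps_const (of_nat v) * fps_X))
           * (fps_exp (of_nat (d * w * v)) + 1) * fps_exp (of_nat (w * v) * x)) $ l"
    (is "?L = (?Kw * ?Kv * ?E * ?X) $ l")
proof -
  let ?F = "Abs_fps (\<lambda>n. poly (gen_euler_poly d \<chi> n) (of_nat v * x) / fact n)"
  let ?T = "Abs_fps (\<lambda>n. alt_power_sum \<chi> n (d * w - 1) / fact n)"
  let ?s = "\<lambda>c::nat. fps_const (of_nat c :: 'a) * fps_X"
  have exp_scale: "fps_exp c oo ?s k = fps_exp (c * of_nat k)" for c k
    by (metis fps_exp_compose_linear mult.commute)
  \<comment> \<open>\<open>?F\<close> is K(t) e^{vxt}; replacing t by wt makes the exponent wvxt,
    symmetric in \<open>w\<close> and \<open>v\<close>.\<close>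
  have "?F oo ?s w = ?Kw * ?X"
    unfolding gen_euler_poly_gf
    by (simp add: fps_compose_mult_distrib exp_scale)
  moreover have "?T oo ?s v = ?Kv * ?E"
    unfolding alt_power_sum_gf[OF assms]
    by (simp add: fps_compose_mult_distrib fps_compose_add_distrib exp_scale)
  ultimately have "?Kw * ?Kv * ?E * ?X = (?F oo ?s w) * (?T oo ?s v)"
    by (simp add: mult_ac)
  then show ?thesis
    unfolding fps_compose_linear
    by (auto simp: fps_mult_nth sum_divide_distrib atLeast0AtMost binomial_fact intro!: sum.cong)
qed

theorem theorem1:
  fixes \<chi> :: "int \<Rightarrow> 'a::field_char_0" and d w1 w2 l :: nat
  assumes "dirichlet_character_of_conductor d \<chi>"
    and "odd d" and "odd w1" and "odd w2"
  shows "(\<Sum>i\<le>l. smult (of_nat (l choose i))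
            (smult (alt_power_sum \<chi> (l - i) (d * w1 - 1) * of_nat w1 ^ i * of_nat w2 ^ (l - i))
              (pcompose (gen_euler_poly d \<chi> i) [:0, of_nat w2:])))
       = (\<Sum>i\<le>l. smult (of_nat (l choose i))
            (smult (alt_power_sum \<chi> (l - i) (d * w2 - 1) * of_nat w2 ^ i * of_nat w1 ^ (l - i))
              (pcompose (gen_euler_poly d \<chi> i) [:0, of_nat w1:])))"
proof -
  have \<chi>: "dirichlet_character d \<chi>"
    using assms by (simp add: dirichlet_character_of_conductor_def)
  show ?thesis (is "?P = ?Q")
  \<comment> \<open>A field of characteristic 0 is infinite, so polynomials agreeing at every point
    are equal.\<close>
  proof (intro poly_eq_poly_eq_iff[THEN iffD1] ext)
    fix x
    \<comment> \<open>Exchanging \<open>w1\<close> and \<open>w2\<close> only permutes the factors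
      of the product series.\<close>
    have "poly ?P x / fact l = poly ?Q x / fact l"
      using gen_euler_alt_power_sum_gf[OF \<chi> \<open>odd d\<close> \<open>odd w1\<close>, of l w2 x]
        gen_euler_alt_power_sum_gf[OF \<chi> \<open>odd d\<close> \<open>odd w2\<close>, of l w1 x]
      by (simp add: poly_sum poly_pcompose mult_ac)
    then show "poly ?P x = poly ?Q x"
      by simp
  qed
qed

end
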